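(* Let $H:T^*\mathbb{R}^n\times\mathbb{R}\to\mathbb{R}$ be a smooth time-dependent Hamiltonian and let $K=u+H\circ\mu$ be the extended Hamiltonian on $T^*(\mathbb{R}^n\times\mathbb{R})$. Let $\psi$ be the one-step map, with constant step $h$, of a symplectic partitioned Runge–Kutta (SPRK) method applied to the Hamiltonian problem with Hamiltonian $K$. Then $\psi$ is a canonical transformation, i.e. there exists a diffeomorphism $\varphi$ of $T^*\mathbb{R}^n\times\mathbb{R}$ such that $(\psi,\varphi)$ is a canonical transformation.
   Context: Points of the extended phase space $T^*(\mathbb{R}^n\times\mathbb{R})\cong\mathbb{R}^{2n+2}$ are written $(q,p,t,u)$, with $q,p\in\mathbb{R}^n$, $t,u\in\mathbb{R}$; $\mu$ is the projection $(q,p,t,u)\mapsto(q,p,t)$, and $\Omega_0=\sum_i \mathrm{d}p_i\wedge \mathrm{d}q^i+\mathrm{d}u\wedge \mathrm{d}t$. Write $\bar q=(q,t)$ (positions) and $\bar p=(p,u)$ (momenta), so that $K=K(\bar q,\bar p)$ and the Hamiltonian problem is $\dot{\bar q}=\partial K/\partial\bar p$, $\dot{\bar p}=-\partial K/\partial\bar q$. An $s$-stage SPRK method is given by real coefficients $a_{i,j}$ and $b_i\neq0$ ($1\le i,j\le s$) with $\sum_i b_i=1$, and the second tableau $\hat a_{i,j}=b_j-a_{j,i}b_j/b_i$, $\hat b_i=b_i$. Its one-step map $(\bar q,\bar p)\mapsto(\bar Q,\bar P)$ is defined by $$\bar k_i=\frac{\partial K}{\partial\bar p}(\bar Q_i,\bar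 P_i),\quad \bar l_i=-\frac{\partial K}{\partial\bar q}(\bar Q_i,\bar P_i),\quad \bar Q_i=\bar q+h\sum_{j=1}^s a_{i,j}\bar k_j,\quad \bar P_i=\bar p+h\sum_{j=1}^s\hat a_{i,j}\bar l_j,$$ $$\bar Q=\bar q+h\sum_{i=1}^s b_i\bar k_i,\qquad \bar P=\bar p+h\sum_{i=1}^s b_i\bar l_i .$$ It is understood that $h$ is such that the stage equations have a unique solution depending smoothly on $(\bar q,\bar p)$ and that the resulting one-step map $\psi$ is a diffeomorphism of $T^*(\mathbb{R}^n\times\mathbb{R})$. A canonical transformation is a pair $(\psi,\varphi)$ of diffeomorphisms, $\psi$ of $T^*(\mathbb{R}^n\times\mathbb{R})$ and $\varphi$ of $T^*\mathbb{R}^n\times\mathbb{R}$, such that (1) $\mu\circ\psi=\varphi\circ\mu$ and (2) $\psi^*\Omega_0=\Omega_0$. *)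

theory Defs
  imports "HOL-Analysis.Analysis"
begin

text \<open>A map is \<open>C\<^sup>k\<^sup>+\<^sup>1\<close> iff it is differentiable everywhere and all its directional derivatives
  are \<open>C\<^sup>k\<close>; in finite dimension this is the usual notion.\<close>

primrec Ck :: "nat \<Rightarrow> ('a::euclidean_space \<Rightarrow> 'b::euclidean_space) \<Rightarrow> bool" where
  "Ck 0 f \<longleftrightarrow> continuous_on UNIV f"
| "Ck (Suc k) f \<longleftrightarrow>
     (\<forall>x. f differentiable (at x)) \<and> (\<forall>v. Ck k (\<lambda>x. frechet_derivative f (at x) v))"

definition smooth :: "('a::euclidean_space \<Rightarrow> 'b::euclidean_space) \<Rightarrow> bool" where
  "smooth f \<longleftrightarrow> (\<forall>k. Ck k f)"

definition diffeomorphism :: "('a::euclidean_space \<Rightarrow> 'b::euclidean_space) \<Rightarrow> bool" where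
  "diffeomorphism f \<longleftrightarrow> bij f \<and> smooth f \<and> smooth (inv f)"

text \<open>On product types the gradient is taken for the product inner product, so it is the vector of all
  partial derivatives.\<close>

definition gradient :: "('a::euclidean_space \<Rightarrow> real) \<Rightarrow> 'a \<Rightarrow> 'a" where
  "gradient f x = (THE D. GDERIV f x :> D)"

text \<open>A point \<open>(q, p, t, u)\<close> of the extended phase space is stored as \<open>((q, t), (p, u))\<close>, i.e. as the
  pair of its position part \<open>(q, t)\<close> and its momentum part \<open>(p, u)\<close>.\<close>

type_synonym 'n config = "(real ^ 'n) \<times> real"
type_synonym 'n ext_phase = "'n config \<times> 'n config"
type_synonym 'n evol_phase = "(real ^ 'n) \<times> (real ^ 'n) \<times> real"

definition q_coord :: "'n::finite \<Rightarrow> 'n ext_phase \<Rightarrow> real" where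
  "q_coord i = (\<lambda>((q, t), (p, u)). q $ i)"

definition p_coord :: "'n::finite \<Rightarrow> 'n ext_phase \<Rightarrow> real" where
  "p_coord i = (\<lambda>((q, t), (p, u)). p $ i)"

definition t_coord :: "'n::finite ext_phase \<Rightarrow> real" where
  "t_coord = (\<lambda>((q, t), (p, u)). t)"

definition u_coord :: "'n::finite ext_phase \<Rightarrow> real" where
  "u_coord = (\<lambda>((q, t), (p, u)). u)"

definition \<mu> :: "'n::finite ext_phase \<Rightarrow> 'n evol_phase" where
  "\<mu> = (\<lambda>((q, t), (p, u)). (q, p, t))"

definition extended_hamiltonian :: "('n::finite evol_phase \<Rightarrow> real) \<Rightarrow> 'n ext_phase \<Rightarrow> real" where
  "extended_hamiltonian H x = u_coord x + H (\<mu> x)"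

text \<open>A differential two-form is a map taking a base point and two tangent vectors.\<close>

type_synonym 'a two_form = "'a \<Rightarrow> 'a \<Rightarrow> 'a \<Rightarrow> real"

definition wedge :: "('a \<Rightarrow> real) \<Rightarrow> ('a \<Rightarrow> real) \<Rightarrow> 'a \<Rightarrow> 'a \<Rightarrow> real" where
  "wedge \<alpha> \<beta> v w = \<alpha> v * \<beta> w - \<alpha> w * \<beta> v"

text \<open>The coordinate functions are linear, so each of them is its own differential at every point.\<close>

definition \<Omega>\<^sub>0 :: "'n::finite ext_phase two_form" where
  "\<Omega>\<^sub>0 x v w = (\<Sum>i\<in>UNIV. wedge (p_coord i) (q_coord i) v w) + wedge u_coord t_coord v w"

definition pullback ::
    "('a::euclidean_space \<Rightarrow> 'b::euclidean_space) \<Rightarrow> 'b two_form \<Rightarrow> 'a two_form" where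
  "pullback f \<omega> x v w =
     \<omega> (f x) (frechet_derivative f (at x) v) (frechet_derivative f (at x) w)"

definition canonical_transformation ::
    "('n::finite ext_phase \<Rightarrow> 'n ext_phase) \<Rightarrow> ('n evol_phase \<Rightarrow> 'n evol_phase) \<Rightarrow> bool" where
  "canonical_transformation \<psi> \<phi> \<longleftrightarrow>
     diffeomorphism \<psi> \<and> diffeomorphism \<phi> \<and> \<mu> \<circ> \<psi> = \<phi> \<circ> \<mu> \<and> pullback \<psi> \<Omega>\<^sub>0 = \<Omega>\<^sub>0"

definition sprk_coefficients :: "('s::finite \<Rightarrow> 's \<Rightarrow> real) \<Rightarrow> ('s \<Rightarrow> real) \<Rightarrow> bool" where
  "sprk_coefficients a b \<longleftrightarrow> (\<forall>i. b i \<noteq> 0) \<and> (\<Sum>i\<in>UNIV. b i) = 1"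

text \<open>The second tableau, determined by \<open>b\<^sub>i * hat i j + b\<^sub>j * a j i = b\<^sub>i * b\<^sub>j\<close>, the symplecticity condition for a
  partitioned method with weights \<open>b\<close> in both tableaux.\<close>

definition hat :: "('s::finite \<Rightarrow> 's \<Rightarrow> real) \<Rightarrow> ('s \<Rightarrow> real) \<Rightarrow> 's \<Rightarrow> 's \<Rightarrow> real" where
  "hat a b i j = b j - a j i * b j / b i"

definition k_slope :: "('n::finite ext_phase \<Rightarrow> real) \<Rightarrow> 'n ext_phase \<Rightarrow> 'n config" where
  "k_slope K z = gradient (\<lambda>y. K (fst z, y)) (snd z)"

definition l_slope :: "('n::finite ext_phase \<Rightarrow> real) \<Rightarrow> 'n ext_phase \<Rightarrow> 'n config" where
  "l_slope K z = - gradient (\<lambda>y. K (y, snd z)) (fst z)"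

text \<open>\<open>Z i\<close> is the pair consisting of the \<open>i\<close>-th position stage and the \<open>i\<close>-th momentum stage.\<close>

definition sprk_stages ::
    "('s::finite \<Rightarrow> 's \<Rightarrow> real) \<Rightarrow> ('s \<Rightarrow> real) \<Rightarrow> real \<Rightarrow> ('n::finite ext_phase \<Rightarrow> real)
      \<Rightarrow> 'n ext_phase \<Rightarrow> ('s \<Rightarrow> 'n ext_phase) \<Rightarrow> bool" where
  "sprk_stages a b h K x Z \<longleftrightarrow>
     (\<forall>i. fst (Z i) = fst x + h *\<^sub>R (\<Sum>j\<in>UNIV. a i j *\<^sub>R k_slope K (Z j)) \<and>
          snd (Z i) = snd x + h *\<^sub>R (\<Sum>j\<in>UNIV. hat a b i j *\<^sub>R l_slope K (Z j)))"

definition sprk_solution ::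
    "('s::finite \<Rightarrow> 's \<Rightarrow> real) \<Rightarrow> ('s \<Rightarrow> real) \<Rightarrow> real \<Rightarrow> ('n::finite ext_phase \<Rightarrow> real)
      \<Rightarrow> 'n ext_phase \<Rightarrow> 's \<Rightarrow> 'n ext_phase" where
  "sprk_solution a b h K x = (THE Z. sprk_stages a b h K x Z)"

definition sprk_solvable ::
    "('s::finite \<Rightarrow> 's \<Rightarrow> real) \<Rightarrow> ('s \<Rightarrow> real) \<Rightarrow> real \<Rightarrow> ('n::finite ext_phase \<Rightarrow> real) \<Rightarrow> bool" where
  "sprk_solvable a b h K \<longleftrightarrow>
     (\<forall>x. \<exists>!Z. sprk_stages a b h K x Z) \<and> (\<forall>i. smooth (\<lambda>x. sprk_solution a b h K x i))"

definition sprk_step ::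
    "('s::finite \<Rightarrow> 's \<Rightarrow> real) \<Rightarrow> ('s \<Rightarrow> real) \<Rightarrow> real \<Rightarrow> ('n::finite ext_phase \<Rightarrow> real)
      \<Rightarrow> 'n ext_phase \<Rightarrow> 'n ext_phase" where
  "sprk_step a b h K x =
     (let Z = sprk_solution a b h K x
      in (fst x + h *\<^sub>R (\<Sum>i\<in>UNIV. b i *\<^sub>R k_slope K (Z i)),
          snd x + h *\<^sub>R (\<Sum>i\<in>UNIV. b i *\<^sub>R l_slope K (Z i))))"

end

theory Submission
  imports Defs
begin

text \<open>
Why the step map is canonical. Two independent facts are needed: the step map preserves the symplectic
form, and it maps fibres of the projection \<open>\<mu>\<close> (the lines parallel to the \<open>u\<close>-axis) to fibres.

Symplecticity. Up to the arrangement of components, \<open>\<Omega>\<^sub>0\<close> is the antisymmetrisation of the pairing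
\<open>(v, w) \<mapsto> snd v \<bullet> fst w\<close> of momentum with position components (lemma \<open>\<Omega>\<^sub>0_eq_inner\<close>). Differentiating
the stage equations at a point shows that the tangent map of the step is again a step of the same
partitioned scheme, with the derivatives \<open>k'\<close>, \<open>l'\<close> of the slopes in place of the slopes. The choice
of the second tableau makes all terms of order \<open>h\<^sup>2\<close> cancel, so the pairing changes by exactly
\<open>h\<close> times a \<open>b\<close>-weighted sum of the terms \<open>P\<^sub>i v \<bullet> k'\<^sub>i w + l'\<^sub>i v \<bullet> Q\<^sub>i w\<close>, where \<open>(Q\<^sub>i, P\<^sub>i)\<close> is the
derivative of the \<open>i\<close>-th stage (lemma \<open>partitioned_bilinear_increment\<close>, a discrete product rule).
Since \<open>(-l', k')\<close> is the Hessian of \<open>K\<close> applied to \<open>(Q\<^sub>i, P\<^sub>i)\<close>, symmetry of the Hessian makes each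
of these terms symmetric in \<open>v\<close> and \<open>w\<close>, so they drop out of \<open>\<Omega>\<^sub>0\<close> (lemma \<open>sprk_step_symplectic\<close>).

Descent. The variable \<open>u\<close> enters \<open>K = u + H \<circ> \<mu>\<close> as an additive term with constant coefficient, so
the gradient of \<open>K\<close> does not depend on it. Hence translating a solution of the stage equations along
the \<open>u\<close>-axis gives a solution for the translated initial point, and by uniqueness the step map
commutes with these translations (lemma \<open>sprk_step_u_shift\<close>). A diffeomorphism that respects the
fibres of a linear projection in this way induces a diffeomorphism of the base
(lemma \<open>diffeomorphism_descends\<close>), which is the required map on \<open>(q, p, t)\<close>-space.
\<close>

section \<open>Maps of class \<open>C\<^sup>k\<close> and smooth maps\<close>

lemma Ck_const: "Ck k (\<lambda>x::'a::euclidean_space. c::'b::euclidean_space)"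
  by (induction k arbitrary: c) (auto simp: frechet_derivative_const)

lemma Ck_add:
  fixes f g :: "'a::euclidean_space \<Rightarrow> 'b::euclidean_space"
  shows "Ck k f \<Longrightarrow> Ck k g \<Longrightarrow> Ck k (\<lambda>x. f x + g x)"
proof (induction k arbitrary: f g)
  case (Suc k)
  have "frechet_derivative (\<lambda>x. f x + g x) (at x) v =
      frechet_derivative f (at x) v + frechet_derivative g (at x) v" for x v
  proof -
    have "((\<lambda>x. f x + g x) has_derivative
        (\<lambda>v. frechet_derivative f (at x) v + frechet_derivative g (at x) v)) (at x)"
      using Suc.prems by (auto simp: frechet_derivative_works intro: has_derivative_add)
    from frechet_derivative_at [OF this] show ?thesis by metis
  qed
  with Suc show ?case
    by (simp add: differentiable_add)
qed (simp add: continuous_on_add)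

lemma Ck_linear_comp:
  fixes f :: "'b::euclidean_space \<Rightarrow> 'c::euclidean_space"
    and L :: "'c \<Rightarrow> 'd::euclidean_space" and M :: "'a::euclidean_space \<Rightarrow> 'b"
  assumes L: "bounded_linear L" and M: "bounded_linear M"
  shows "Ck k f \<Longrightarrow> Ck k (\<lambda>x. L (f (M x)))"
proof (induction k arbitrary: f)
  case 0
  then have "continuous_on UNIV f" by simp
  then show ?case
    unfolding Ck.simps
    by (intro bounded_linear.continuous_on [OF L] continuous_on_compose2 [OF _ linear_continuous_on [OF M]]) auto
next
  case (Suc k)
  have D: "((\<lambda>x. L (f (M x))) has_derivative (\<lambda>v. L (frechet_derivative f (at (M x)) (M v)))) (at x)" for x
  proof -
    have "(f has_derivative frechet_derivative f (at (M x))) (at (M x))"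
      using Suc.prems by (simp add: frechet_derivative_works)
    from has_derivative_compose [OF bounded_linear_imp_has_derivative [OF M] this]
    show ?thesis by (rule bounded_linear.has_derivative [OF L])
  qed
  have "frechet_derivative (\<lambda>x. L (f (M x))) (at x) v = L (frechet_derivative f (at (M x)) (M v))" for x v
    using frechet_derivative_at [OF D] by metis
  moreover have "Ck k (\<lambda>x. L (frechet_derivative f (at (M x)) (M v)))" for v
    using Suc.prems by (intro Suc.IH) simp
  moreover have "(\<lambda>x. L (f (M x))) differentiable (at x)" for x
    using D unfolding differentiable_def by blast
  ultimately show ?case by simp
qed

lemma Ck_bounded_linear:
  assumes "bounded_linear (L :: 'a::euclidean_space \<Rightarrow> 'b::euclidean_space)"
  shows "Ck k L"
proof (cases k)
  case 0
  then show ?thesis by (simp add: linear_continuous_on assms)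
next
  case (Suc m)
  have "frechet_derivative L (at x) = L" for x
    using frechet_derivative_at [OF bounded_linear_imp_has_derivative [OF assms]] by metis
  then show ?thesis
    by (simp add: Suc Ck_const bounded_linear_imp_differentiable assms)
qed

lemma smooth_linear_comp:
  assumes "smooth f" "bounded_linear L" "bounded_linear M"
  shows "smooth (\<lambda>x. L (f (M x)))"
  using assms by (simp add: smooth_def Ck_linear_comp)

lemma smooth_bounded_linear: "bounded_linear f \<Longrightarrow> smooth f"
  by (simp add: smooth_def Ck_bounded_linear)

lemma smooth_add: "smooth f \<Longrightarrow> smooth g \<Longrightarrow> smooth (\<lambda>x. f x + g x)"
  by (simp add: smooth_def Ck_add)

lemma Ck_2_imp_differentiable: "Ck 2 f \<Longrightarrow> f differentiable (at x)"
  by (simp add: numeral_2_eq_2)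

lemma smooth_imp_differentiable: "smooth f \<Longrightarrow> f differentiable (at x)"
  unfolding smooth_def by (metis Ck.simps(2))

section \<open>Symmetry of the second derivative\<close>

text \<open>The second difference of \<open>f\<close> over the parallelogram spanned by \<open>s v\<close> and \<open>s w\<close> is a difference,
  along \<open>v\<close>, of the increments of \<open>f\<close> in direction \<open>w\<close>. One mean value theorem along \<open>v\<close> and a second
  one along \<open>w\<close> turn it into a mixed second derivative at a point of the parallelogram. Its value is
  symmetric in \<open>v\<close> and \<open>w\<close>, whereas the order of differentiation on the right is not.\<close>

lemma second_difference_mean_value:
  fixes f :: "'a::euclidean_space \<Rightarrow> real"
  assumes f: "\<And>y. f differentiable (at y)"
    and fv: "\<And>y. (\<lambda>z. frechet_derivative f (at z) v) differentiable (at y)"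
    and "s > 0"
  obtains \<xi> \<eta> where "0 < \<xi>" "\<xi> < s" "0 < \<eta>" "\<eta> < s"
    "f (x + s *\<^sub>R v + s *\<^sub>R w) - f (x + s *\<^sub>R v) - f (x + s *\<^sub>R w) + f x =
      s * s * frechet_derivative (\<lambda>z. frechet_derivative f (at z) v) (at (x + \<xi> *\<^sub>R v + \<eta> *\<^sub>R w)) w"
proof -
  let ?fv = "\<lambda>z. frechet_derivative f (at z) v"
  have line: "((\<lambda>r. g (y + r *\<^sub>R d)) has_real_derivative frechet_derivative g (at (y + r *\<^sub>R d)) d) (at r)"
    if g: "\<And>y. g differentiable (at y)" for g :: "'a \<Rightarrow> real" and y d r
  proof -
    have g': "(g has_derivative frechet_derivative g (at (y + r *\<^sub>R d))) (at (y + r *\<^sub>R d))"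
      using g by (simp add: frechet_derivative_works)
    have "((\<lambda>r. y + r *\<^sub>R d) has_derivative (\<lambda>r. r *\<^sub>R d)) (at r)"
      by (auto intro!: derivative_eq_intros)
    from has_derivative_compose [OF this g']
    have "((\<lambda>r. g (y + r *\<^sub>R d)) has_derivative (\<lambda>r'. frechet_derivative g (at (y + r *\<^sub>R d)) (r' *\<^sub>R d))) (at r)" .
    then show ?thesis
      using linear_scale [OF linear_frechet_derivative [OF g]]
      by (simp add: has_field_derivative_def mult.commute [of _ "frechet_derivative g (at (y + r *\<^sub>R d)) d"]
          mult_commute_abs)
  qed
  have "\<exists>\<xi>>0. \<xi> < s \<and> (f ((x + s *\<^sub>R w) + s *\<^sub>R v) - f (x + s *\<^sub>R v)) - (f ((x + s *\<^sub>R w) + 0 *\<^sub>R v) - f (x + 0 *\<^sub>R v))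
      = (s - 0) * (?fv ((x + s *\<^sub>R w) + \<xi> *\<^sub>R v) - ?fv (x + \<xi> *\<^sub>R v))"
    by (rule MVT2 [OF \<open>s > 0\<close>]) (intro derivative_intros line f)
  then obtain \<xi> where \<xi>: "0 < \<xi>" "\<xi> < s"
    and 1: "f (x + s *\<^sub>R v + s *\<^sub>R w) - f (x + s *\<^sub>R v) - f (x + s *\<^sub>R w) + f x
      = s * (?fv (x + \<xi> *\<^sub>R v + s *\<^sub>R w) - ?fv (x + \<xi> *\<^sub>R v))"
    by (auto simp: algebra_simps)
  have "\<exists>\<eta>>0. \<eta> < s \<and> ?fv (x + \<xi> *\<^sub>R v + s *\<^sub>R w) - ?fv (x + \<xi> *\<^sub>R v + 0 *\<^sub>R w)
      = (s - 0) * frechet_derivative ?fv (at (x + \<xi> *\<^sub>R v + \<eta> *\<^sub>R w)) w"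
    by (rule MVT2 [OF \<open>s > 0\<close>]) (intro line fv)
  with 1 \<xi> that show ?thesis by auto
qed

text \<open>Expanding the same second difference in both orders gives equality of the two mixed derivatives,
  each at some point of a parallelogram as small as desired; continuity moves both points to \<open>x\<close>.\<close>

lemma symmetric_second_derivative:
  fixes f :: "'a::euclidean_space \<Rightarrow> real"
  assumes f: "Ck 2 f"
  shows "frechet_derivative (\<lambda>z. frechet_derivative f (at z) v) (at x) w =
    frechet_derivative (\<lambda>z. frechet_derivative f (at z) w) (at x) v" (is "?D v w x = ?D w v x")
proof -
  from f have d: "f differentiable (at y)" "(\<lambda>z. frechet_derivative f (at z) v) differentiable (at y)"
    and c: "continuous_on UNIV (\<lambda>y. ?D v w y)" for y v w
    by (simp_all add: numeral_2_eq_2)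
  have "\<bar>?D v w x - ?D w v x\<bar> \<le> 0 + e" if "e > 0" for e :: real
  proof -
    have "\<exists>\<delta>>0. \<forall>y. dist y x < \<delta> \<longrightarrow> \<bar>?D v w y - ?D v w x\<bar> < e / 2" for v w
      using c [of v w] that unfolding continuous_on_iff dist_real_def
      by (metis UNIV_I half_gt_zero)
    then obtain \<delta>1 \<delta>2 where \<delta>: "\<delta>1 > 0" "\<delta>2 > 0"
      and c1: "\<And>y. dist y x < \<delta>1 \<Longrightarrow> \<bar>?D v w y - ?D v w x\<bar> < e / 2"
      and c2: "\<And>y. dist y x < \<delta>2 \<Longrightarrow> \<bar>?D w v y - ?D w v x\<bar> < e / 2"
      by meson
    (* The parallelogram with sides s v and s w then lies in both continuity neighbourhoods of x. The
       summand 1 keeps the denominator positive when v = w = 0 and makes the bound on dist strict. *)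
    define s where "s = min \<delta>1 \<delta>2 / (norm v + norm w + 1)"
    have N: "norm v + norm w + 1 > 0" by (smt (verit) norm_ge_zero)
    with \<delta> have s: "s > 0" by (simp add: s_def)
    have close: "dist (x + \<xi> *\<^sub>R v + \<eta> *\<^sub>R w) x < min \<delta>1 \<delta>2"
      if "0 < \<xi>" "\<xi> < s" "0 < \<eta>" "\<eta> < s" for \<xi> \<eta>
    proof -
      have "dist (x + \<xi> *\<^sub>R v + \<eta> *\<^sub>R w) x \<le> \<xi> * norm v + \<eta> * norm w"
        using norm_triangle_ineq [of "\<xi> *\<^sub>R v" "\<eta> *\<^sub>R w"] that by (simp add: dist_norm add.assoc)
      also have "\<dots> \<le> s * norm v + s * norm w"
        using that by (intro add_mono mult_right_mono) auto
      also have "\<dots> < s * (norm v + norm w + 1)"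
        using s by (simp add: algebra_simps)
      also have "\<dots> = min \<delta>1 \<delta>2"
        using N by (simp add: s_def)
      finally show ?thesis .
    qed
    obtain \<xi> \<eta> where 1: "0 < \<xi>" "\<xi> < s" "0 < \<eta>" "\<eta> < s"
      "f (x + s *\<^sub>R v + s *\<^sub>R w) - f (x + s *\<^sub>R v) - f (x + s *\<^sub>R w) + f x
        = s * s * ?D v w (x + \<xi> *\<^sub>R v + \<eta> *\<^sub>R w)"
      using second_difference_mean_value [OF d s] .
    obtain \<xi>' \<eta>' where 2: "0 < \<xi>'" "\<xi>' < s" "0 < \<eta>'" "\<eta>' < s"
      "f (x + s *\<^sub>R w + s *\<^sub>R v) - f (x + s *\<^sub>R w) - f (x + s *\<^sub>R v) + f x
        = s * s * ?D w v (x + \<xi>' *\<^sub>R w + \<eta>' *\<^sub>R v)"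
      using second_difference_mean_value [OF d s] .
    have "x + s *\<^sub>R w + s *\<^sub>R v = x + s *\<^sub>R v + s *\<^sub>R w" by simp
    with 1(5) 2(5) have "s * s * ?D v w (x + \<xi> *\<^sub>R v + \<eta> *\<^sub>R w) = s * s * ?D w v (x + \<xi>' *\<^sub>R w + \<eta>' *\<^sub>R v)"
      by (metis add.commute diff_diff_eq)
    with s have eq: "?D v w (x + \<xi> *\<^sub>R v + \<eta> *\<^sub>R w) = ?D w v (x + \<xi>' *\<^sub>R w + \<eta>' *\<^sub>R v)"
      by simp
    have "x + \<xi>' *\<^sub>R w + \<eta>' *\<^sub>R v = x + \<eta>' *\<^sub>R v + \<xi>' *\<^sub>R w" by simp
    then have "dist (x + \<xi>' *\<^sub>R w + \<eta>' *\<^sub>R v) x < \<delta>2" "dist (x + \<xi> *\<^sub>R v + \<eta> *\<^sub>R w) x < \<delta>1"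
      using close [OF 1(1-4)] close [OF 2(3,4,1,2)] by (simp_all only: min_less_iff_conj)
    from c2 [OF this(1)] c1 [OF this(2)] eq show ?thesis by linarith
  qed
  then have "\<bar>?D v w x - ?D w v x\<bar> \<le> 0" by (rule field_le_epsilon)
  then show ?thesis by simp
qed

section \<open>Gradients\<close>

lemma GDERIV_imp_gradient:
  assumes "GDERIV f x :> D"
  shows "gradient f x = D"
  unfolding gradient_def
proof (rule the_equality)
  show "GDERIV f x :> D" by (rule assms)
next
  fix E assume "GDERIV f x :> E"
  then have "(\<lambda>h. h \<bullet> E) = (\<lambda>h. h \<bullet> D)"
    using assms unfolding gderiv_def by (rule has_derivative_unique)
  then show "E = D" by (metis vector_eq_ldot)
qed

lemma GDERIV_gradient:
  fixes f :: "'a::euclidean_space \<Rightarrow> real"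
  assumes "f differentiable (at x)"
  shows "GDERIV f x :> gradient f x"
proof -
  let ?D = "\<Sum>e\<in>Basis. frechet_derivative f (at x) e *\<^sub>R e"
  have lin: "linear (frechet_derivative f (at x))"
    using assms by (rule linear_frechet_derivative)
  have "frechet_derivative f (at x) h = h \<bullet> ?D" for h
  proof -
    have "frechet_derivative f (at x) h = frechet_derivative f (at x) (\<Sum>e\<in>Basis. (h \<bullet> e) *\<^sub>R e)"
      by (simp add: euclidean_representation)
    also have "\<dots> = h \<bullet> ?D"
      by (simp add: linear_sum [OF lin] linear_scale [OF lin] inner_sum_right mult.commute)
    finally show ?thesis .
  qed
  then have "frechet_derivative f (at x) = (\<lambda>h. h \<bullet> ?D)" by blast
  then have "GDERIV f x :> ?D"
    using assms frechet_derivative_works [of f] by (simp add: gderiv_def)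
  then show ?thesis by (simp add: GDERIV_imp_gradient)
qed

lemma inner_gradient:
  fixes f :: "'a::euclidean_space \<Rightarrow> real"
  assumes "f differentiable (at x)"
  shows "v \<bullet> gradient f x = frechet_derivative f (at x) v"
  using frechet_derivative_at [OF GDERIV_gradient [OF assms, unfolded gderiv_def]] by metis

lemma gradient_translate:
  fixes f :: "'a::euclidean_space \<Rightarrow> real"
  assumes "f differentiable (at (x + d))" and "\<And>y. f (y + d) = f y + c"
  shows "gradient f (x + d) = gradient f x"
proof -
  have "(f has_derivative (\<lambda>h. h \<bullet> gradient f (x + d))) (at (x + d))"
    using GDERIV_gradient [OF assms(1)] by (simp add: gderiv_def)
  moreover have "((\<lambda>y. y + d) has_derivative (\<lambda>h. h)) (at x)"
    by (auto intro!: derivative_eq_intros)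
  ultimately have "((\<lambda>y. f (y + d)) has_derivative (\<lambda>h. h \<bullet> gradient f (x + d))) (at x)"
    by (rule has_derivative_compose [rotated])
  then have "((\<lambda>y. f (y + d) - c) has_derivative (\<lambda>h. h \<bullet> gradient f (x + d))) (at x)"
    by (auto intro!: derivative_eq_intros)
  then have "GDERIV f x :> gradient f (x + d)"
    by (simp add: gderiv_def assms(2))
  then show ?thesis by (simp add: GDERIV_imp_gradient)
qed

lemma gradient_differentiable:
  fixes f :: "'a::euclidean_space \<Rightarrow> real"
  assumes "Ck 2 f"
  shows "gradient f differentiable (at x)"
proof -
  have "gradient f y = (\<Sum>e\<in>Basis. frechet_derivative f (at y) e *\<^sub>R e)" for y
    using assms euclidean_representation [of "gradient f y"]
    by (simp add: numeral_2_eq_2 inner_gradient [symmetric] inner_commute [of _ "gradient f y"])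
  then have "gradient f = (\<lambda>y. \<Sum>e\<in>Basis. frechet_derivative f (at y) e *\<^sub>R e)" by (rule ext)
  then show ?thesis
    using assms by (simp add: numeral_2_eq_2)
qed

text \<open>The derivative of the gradient is the Hessian, regarded as a linear map; this is its
  self-adjointness.\<close>

lemma gradient_derivative_symmetric:
  fixes f :: "'a::euclidean_space \<Rightarrow> real"
  assumes "Ck 2 f"
  shows "v \<bullet> frechet_derivative (gradient f) (at x) w = w \<bullet> frechet_derivative (gradient f) (at x) v"
proof -
  have second: "v \<bullet> frechet_derivative (gradient f) (at x) w
      = frechet_derivative (\<lambda>y. frechet_derivative f (at y) v) (at x) w" for v w
  proof -
    have "(gradient f has_derivative frechet_derivative (gradient f) (at x)) (at x)"
      using gradient_differentiable [OF assms] frechet_derivative_works by blast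
    then have "((\<lambda>y. v \<bullet> gradient f y) has_derivative
        (\<lambda>w. v \<bullet> frechet_derivative (gradient f) (at x) w)) (at x)"
      by (rule has_derivative_inner_right)
    moreover have "(\<lambda>y. v \<bullet> gradient f y) = (\<lambda>y. frechet_derivative f (at y) v)"
      using assms by (simp add: numeral_2_eq_2 inner_gradient)
    ultimately show ?thesis
      using frechet_derivative_at by metis
  qed
  show ?thesis
    unfolding second by (rule symmetric_second_derivative [OF assms])
qed

text \<open>Once the two slopes are, up to sign, components of one total gradient, their derivatives are blocks
  of one Hessian, whose symmetry also relates the mixed blocks of the two slopes to each other.\<close>

lemma k_slope_eq_gradient:
  assumes "K differentiable (at z)"
  shows "k_slope K z = snd (gradient K z)"
proof -
  have "(K has_derivative (\<lambda>h. h \<bullet> gradient K z)) (at (fst z, snd z))"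
    using GDERIV_gradient [OF assms] by (simp add: gderiv_def)
  moreover have "((\<lambda>y. (fst z, y)) has_derivative (\<lambda>h. (0, h))) (at (snd z))"
    by (auto intro!: derivative_eq_intros)
  ultimately have "((\<lambda>y. K (fst z, y)) has_derivative (\<lambda>h. (0, h) \<bullet> gradient K z)) (at (snd z))"
    by (rule has_derivative_compose [rotated])
  then show ?thesis
    unfolding k_slope_def by (intro GDERIV_imp_gradient) (simp add: gderiv_def inner_prod_def)
qed

lemma l_slope_eq_gradient:
  assumes "K differentiable (at z)"
  shows "l_slope K z = - fst (gradient K z)"
proof -
  have "(K has_derivative (\<lambda>h. h \<bullet> gradient K z)) (at (fst z, snd z))"
    using GDERIV_gradient [OF assms] by (simp add: gderiv_def)
  moreover have "((\<lambda>y. (y, snd z)) has_derivative (\<lambda>h. (h, 0))) (at (fst z))"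
    by (auto intro!: derivative_eq_intros)
  ultimately have "((\<lambda>y. K (y, snd z)) has_derivative (\<lambda>h. (h, 0) \<bullet> gradient K z)) (at (fst z))"
    by (rule has_derivative_compose [rotated])
  then have "gradient (\<lambda>y. K (y, snd z)) (fst z) = fst (gradient K z)"
    by (intro GDERIV_imp_gradient) (simp add: gderiv_def inner_prod_def)
  then show ?thesis
    by (simp add: l_slope_def)
qed

section \<open>Symplecticity\<close>

lemma coord_eqs:
  "q_coord i z = fst (fst z) $ i" "p_coord i z = fst (snd z) $ i"
  "t_coord z = snd (fst z)" "u_coord z = snd (snd z)"
  by (simp_all add: q_coord_def p_coord_def t_coord_def u_coord_def split: prod.splits)

lemma \<Omega>\<^sub>0_eq_inner:
  fixes x v w :: "'n::finite ext_phase"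
  shows "\<Omega>\<^sub>0 x v w = snd v \<bullet> fst w - snd w \<bullet> fst v"
  by (simp add: \<Omega>\<^sub>0_def wedge_def coord_eqs inner_prod_def inner_vec_def sum_subtractf)

text \<open>A discrete product rule for \<open>p \<bullet> q\<close>: each increment is paired with the stage value of the other
  factor. Expanding both sides, the terms of order \<open>h\<close> agree at once, and the coefficient of \<open>l\<^sub>i \<bullet> k\<^sub>j\<close> at order
  \<open>h\<^sup>2\<close> is \<open>b\<^sub>i b\<^sub>j\<close> on the left and \<open>b\<^sub>j hat\<^sub>j\<^sub>i + b\<^sub>i a\<^sub>i\<^sub>j\<close> on the right. These are equal precisely by
  the choice of the second tableau.\<close>

lemma partitioned_bilinear_increment:
  fixes q p :: "'a::real_inner" and k l :: "'s::finite \<Rightarrow> 'a"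
  assumes b: "\<And>i. b i \<noteq> 0"
  shows "(p + h *\<^sub>R (\<Sum>i\<in>UNIV. b i *\<^sub>R l i)) \<bullet> (q + h *\<^sub>R (\<Sum>i\<in>UNIV. b i *\<^sub>R k i)) =
    p \<bullet> q + h * (\<Sum>i\<in>UNIV. b i *
      ((p + h *\<^sub>R (\<Sum>j\<in>UNIV. hat a b i j *\<^sub>R l j)) \<bullet> k i + l i \<bullet> (q + h *\<^sub>R (\<Sum>j\<in>UNIV. a i j *\<^sub>R k j))))"
proof -
  have "(\<Sum>i\<in>UNIV. b i * ((\<Sum>j\<in>UNIV. hat a b i j *\<^sub>R l j) \<bullet> k i))
      + (\<Sum>i\<in>UNIV. b i * (l i \<bullet> (\<Sum>j\<in>UNIV. a i j *\<^sub>R k j)))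
      = (\<Sum>i\<in>UNIV. \<Sum>j\<in>UNIV. b i * hat a b i j * (l j \<bullet> k i))
      + (\<Sum>i\<in>UNIV. \<Sum>j\<in>UNIV. b i * a i j * (l i \<bullet> k j))"
    by (simp add: inner_sum_left inner_sum_right sum_distrib_left mult.assoc)
  also have "(\<Sum>i\<in>UNIV. \<Sum>j\<in>UNIV. b i * hat a b i j * (l j \<bullet> k i))
      = (\<Sum>i\<in>UNIV. \<Sum>j\<in>UNIV. b j * hat a b j i * (l i \<bullet> k j))"
    by (rule sum.swap)
  also have "\<dots> + (\<Sum>i\<in>UNIV. \<Sum>j\<in>UNIV. b i * a i j * (l i \<bullet> k j))
      = (\<Sum>i\<in>UNIV. \<Sum>j\<in>UNIV. b i * b j * (l i \<bullet> k j))"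
    using b by (simp add: hat_def sum.distrib [symmetric] field_simps)
  also have "\<dots> = (\<Sum>i\<in>UNIV. b i *\<^sub>R l i) \<bullet> (\<Sum>i\<in>UNIV. b i *\<^sub>R k i)"
    unfolding inner_sum_left [of _ UNIV] unfolding inner_sum_right by (simp add: mult_ac)
  finally have quad: "(\<Sum>i\<in>UNIV. b i * ((\<Sum>j\<in>UNIV. hat a b i j *\<^sub>R l j) \<bullet> k i))
      + (\<Sum>i\<in>UNIV. b i * (l i \<bullet> (\<Sum>j\<in>UNIV. a i j *\<^sub>R k j)))
      = (\<Sum>i\<in>UNIV. b i *\<^sub>R l i) \<bullet> (\<Sum>i\<in>UNIV. b i *\<^sub>R k i)" .
  have "(\<Sum>i\<in>UNIV. b i *
      ((p + h *\<^sub>R (\<Sum>j\<in>UNIV. hat a b i j *\<^sub>R l j)) \<bullet> k i + l i \<bullet> (q + h *\<^sub>R (\<Sum>j\<in>UNIV. a i j *\<^sub>R k j))))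
    = (\<Sum>i\<in>UNIV. b i * (p \<bullet> k i)) + (\<Sum>i\<in>UNIV. b i * (l i \<bullet> q))
      + h * ((\<Sum>i\<in>UNIV. b i * ((\<Sum>j\<in>UNIV. hat a b i j *\<^sub>R l j) \<bullet> k i))
      + (\<Sum>i\<in>UNIV. b i * (l i \<bullet> (\<Sum>j\<in>UNIV. a i j *\<^sub>R k j))))"
    by (simp add: inner_add_left inner_add_right sum.distrib sum_distrib_left distrib_left mult.left_commute)
  also have "\<dots> = p \<bullet> (\<Sum>i\<in>UNIV. b i *\<^sub>R k i) + (\<Sum>i\<in>UNIV. b i *\<^sub>R l i) \<bullet> q
      + h * ((\<Sum>i\<in>UNIV. b i *\<^sub>R l i) \<bullet> (\<Sum>i\<in>UNIV. b i *\<^sub>R k i))"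
    unfolding quad by (simp add: inner_sum_left inner_sum_right)
  finally show ?thesis
    by (simp add: inner_add_left inner_add_right algebra_simps)
qed

lemma ex1_sprk_stages:
  assumes "sprk_solvable a b h K"
  shows "\<exists>!Z. sprk_stages a b h K x Z"
  by (rule spec [OF conjunct1 [OF assms [unfolded sprk_solvable_def]]])

lemma smooth_sprk_solution:
  assumes "sprk_solvable a b h K"
  shows "smooth (\<lambda>x. sprk_solution a b h K x i)"
  by (rule spec [OF conjunct2 [OF assms [unfolded sprk_solvable_def]]])

lemma sprk_stages_sprk_solution:
  assumes "sprk_solvable a b h K"
  shows "sprk_stages a b h K x (sprk_solution a b h K x)"
  unfolding sprk_solution_def by (rule theI' [OF ex1_sprk_stages [OF assms]])

lemma sprk_solution_eq:
  assumes "sprk_solvable a b h K" "sprk_stages a b h K x Z"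
  shows "sprk_solution a b h K x = Z"
  using ex1_sprk_stages [OF assms(1)] unfolding sprk_solution_def
  by (rule the1_equality) (rule assms(2))

text \<open>The tangent map of the step obeys the equations of the scheme itself, with the linearised slopes
  \<open>k\<close> and \<open>l\<close>, so the discrete product rule applies to a pair of tangent vectors. Antisymmetrising,
  the increments of the two pairings cancel stage by stage because the Hessian of \<open>K\<close> is symmetric.\<close>

lemma sprk_step_symplectic:
  fixes K :: "'n::finite ext_phase \<Rightarrow> real"
  assumes K: "Ck 2 K" and b: "\<And>i. b i \<noteq> 0" and solv: "sprk_solvable a b h K"
  shows "pullback (sprk_step a b h K) \<Omega>\<^sub>0 = \<Omega>\<^sub>0"
proof (intro ext)
  fix x v w :: "'n ext_phase"
  define Z where "Z = (\<lambda>i x. sprk_solution a b h K x i)"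
  define Z' where "Z' = (\<lambda>i. frechet_derivative (Z i) (at x))"
  define g' where "g' = (\<lambda>i v. frechet_derivative (gradient K) (at (Z i x)) (Z' i v))"
  define k where "k = (\<lambda>i v. snd (g' i v))"
  define l where "l = (\<lambda>i v. - fst (g' i v))"
  have K1: "K differentiable (at z)" for z
    using K by (rule Ck_2_imp_differentiable)
  have Z': "(Z i has_derivative Z' i) (at x)" for i
    using smooth_imp_differentiable [OF smooth_sprk_solution [OF solv]]
    by (simp add: Z_def Z'_def frechet_derivative_works)
  have "(gradient K has_derivative frechet_derivative (gradient K) (at z)) (at z)" for z
    using gradient_differentiable [OF K] frechet_derivative_works by blast
  from has_derivative_compose [OF Z' this]
  have g': "((\<lambda>x. gradient K (Z i x)) has_derivative g' i) (at x)" for i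
    by (simp add: g'_def)
  have k': "((\<lambda>x. k_slope K (Z i x)) has_derivative k i) (at x)" for i
    using has_derivative_snd [OF g', of i] by (simp add: k_slope_eq_gradient [OF K1] k_def)
  have l': "((\<lambda>x. l_slope K (Z i x)) has_derivative l i) (at x)" for i
    using has_derivative_minus [OF has_derivative_fst [OF g', of i]]
    by (simp add: l_slope_eq_gradient [OF K1] l_def)
  (* Stages and step are updates of the same form, with rows of the tableaux and with the weights as
     coefficients respectively. *)
  have update: "((\<lambda>x. (fst x + h *\<^sub>R (\<Sum>j\<in>UNIV. c j *\<^sub>R k_slope K (Z j x)),
        snd x + h *\<^sub>R (\<Sum>j\<in>UNIV. d j *\<^sub>R l_slope K (Z j x)))) has_derivative
      (\<lambda>v. (fst v + h *\<^sub>R (\<Sum>j\<in>UNIV. c j *\<^sub>R k j v), snd v + h *\<^sub>R (\<Sum>j\<in>UNIV. d j *\<^sub>R l j v)))) (at x)" for c d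
    by (auto intro!: derivative_eq_intros k' l')
  have Z_eq: "Z i = (\<lambda>x. (fst x + h *\<^sub>R (\<Sum>j\<in>UNIV. a i j *\<^sub>R k_slope K (Z j x)),
        snd x + h *\<^sub>R (\<Sum>j\<in>UNIV. hat a b i j *\<^sub>R l_slope K (Z j x))))" for i
    using sprk_stages_sprk_solution [OF solv] unfolding sprk_stages_def Z_def
    by (metis surjective_pairing)
  have "Z' i = (\<lambda>v. (fst v + h *\<^sub>R (\<Sum>j\<in>UNIV. a i j *\<^sub>R k j v),
        snd v + h *\<^sub>R (\<Sum>j\<in>UNIV. hat a b i j *\<^sub>R l j v)))" for i
    using update [of "a i" "hat a b i"] unfolding Z_eq [symmetric] by (rule has_derivative_unique [OF Z'])
  then have stage: "fst (Z' i v) = fst v + h *\<^sub>R (\<Sum>j\<in>UNIV. a i j *\<^sub>R k j v)"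
    "snd (Z' i v) = snd v + h *\<^sub>R (\<Sum>j\<in>UNIV. hat a b i j *\<^sub>R l j v)" for i v
    by simp_all
  have "sprk_step a b h K = (\<lambda>x. (fst x + h *\<^sub>R (\<Sum>j\<in>UNIV. b j *\<^sub>R k_slope K (Z j x)),
        snd x + h *\<^sub>R (\<Sum>j\<in>UNIV. b j *\<^sub>R l_slope K (Z j x))))"
    by (simp add: fun_eq_iff sprk_step_def Z_def Let_def)
  then have step: "frechet_derivative (sprk_step a b h K) (at x) v =
      (fst v + h *\<^sub>R (\<Sum>j\<in>UNIV. b j *\<^sub>R k j v), snd v + h *\<^sub>R (\<Sum>j\<in>UNIV. b j *\<^sub>R l j v))" for v
    by (simp only: frechet_derivative_at [OF update [of b b], symmetric])
  have "snd (Z' i v) \<bullet> k i w + l i v \<bullet> fst (Z' i w) = snd (Z' i w) \<bullet> k i v + l i w \<bullet> fst (Z' i v)" for i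
    using gradient_derivative_symmetric [OF K, of "Z' i v" "Z i x" "Z' i w"]
    by (simp add: g'_def k_def l_def inner_prod_def inner_commute algebra_simps)
  then show "pullback (sprk_step a b h K) \<Omega>\<^sub>0 x v w = \<Omega>\<^sub>0 x v w"
    unfolding pullback_def \<Omega>\<^sub>0_eq_inner step fst_conv snd_conv
      partitioned_bilinear_increment [OF b, where a = a] stage [symmetric]
    by simp
qed

section \<open>Descent to the evolution phase space\<close>

text \<open>Since \<open>\<psi>\<close> maps fibres of \<open>P\<close> to fibres, the induced map of the base does not depend on the linear
  section \<open>S\<close> through which it is computed. Since distinct fibres go to distinct fibres, the same holds
  for the inverse of \<open>\<psi>\<close>, so the maps induced by \<open>\<psi>\<close> and by its inverse are mutually inverse. Both are
  smooth, being compositions of smooth and linear maps.\<close>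

lemma diffeomorphism_descends:
  fixes \<psi> :: "'a::euclidean_space \<Rightarrow> 'a" and P :: "'a \<Rightarrow> 'b::euclidean_space"
  assumes \<psi>: "diffeomorphism \<psi>" and P: "bounded_linear P" and S: "bounded_linear S"
    and PS: "\<And>y. P (S y) = y"
    and fib: "\<And>x y. P (\<psi> x) = P (\<psi> y) \<longleftrightarrow> P x = P y"
  shows "diffeomorphism (\<lambda>y. P (\<psi> (S y)))" and "P (\<psi> x) = P (\<psi> (S (P x)))"
proof -
  have \<psi>_inv: "\<psi> (inv \<psi> x) = x" for x
    using \<psi> unfolding diffeomorphism_def by (simp add: bij_is_surj surj_f_inv_f)
  have 1: "P (\<psi> (S (P x))) = P (\<psi> x)" for x
    by (simp add: fib PS)
  have left: "P (inv \<psi> (S (P (\<psi> (S y))))) = y" for y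
    using fib [of "inv \<psi> (S (P (\<psi> (S y))))" "S y"] by (simp add: \<psi>_inv PS)
  have right: "P (\<psi> (S (P (inv \<psi> (S y))))) = y" for y
    by (simp add: 1 \<psi>_inv PS)
  have "bij (\<lambda>y. P (\<psi> (S y)))"
    by (rule o_bij [of "\<lambda>y. P (inv \<psi> (S y))"]) (auto simp: left right)
  moreover have "inv (\<lambda>y. P (\<psi> (S y))) = (\<lambda>y. P (inv \<psi> (S y)))"
    by (rule inv_equality) (auto simp: left right)
  ultimately show "diffeomorphism (\<lambda>y. P (\<psi> (S y)))"
    using \<psi> by (simp add: diffeomorphism_def smooth_linear_comp P S)
  show "P (\<psi> x) = P (\<psi> (S (P x)))"
    by (simp add: 1)
qed

lemma \<mu>_eq: "\<mu> z = (fst (fst z), fst (snd z), snd (fst z))"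
  by (simp add: \<mu>_def split: prod.splits)

lemma bounded_linear_\<mu>: "bounded_linear \<mu>"
  unfolding \<mu>_eq
  by (intro bounded_linear_Pair bounded_linear_fst_comp bounded_linear_snd_comp bounded_linear_ident)

lemma bounded_linear_u_coord: "bounded_linear u_coord"
  unfolding coord_eqs
  by (intro bounded_linear_fst_comp bounded_linear_snd_comp bounded_linear_ident)

lemma smooth_extended_hamiltonian:
  assumes "smooth H"
  shows "smooth (extended_hamiltonian H)"
proof -
  have "smooth (\<lambda>x. H (\<mu> x))"
    using assms bounded_linear_ident bounded_linear_\<mu> by (rule smooth_linear_comp)
  then have "smooth (\<lambda>x. u_coord x + H (\<mu> x))"
    by (rule smooth_add [OF smooth_bounded_linear [OF bounded_linear_u_coord]])
  moreover have "extended_hamiltonian H = (\<lambda>x. u_coord x + H (\<mu> x))"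
    by (rule ext) (rule extended_hamiltonian_def)
  ultimately show ?thesis by simp
qed

definition u_shift :: "real \<Rightarrow> 'n::finite ext_phase" where
  "u_shift c = ((0, 0), (0, c))"

lemma \<mu>_eq_iff_u_shift: "\<mu> x = \<mu> y \<longleftrightarrow> (\<exists>c. y = x + u_shift c)"
proof
  assume "\<mu> x = \<mu> y"
  then have "y = x + u_shift (u_coord y - u_coord x)"
    by (simp add: \<mu>_eq coord_eqs u_shift_def prod_eq_iff)
  then show "\<exists>c. y = x + u_shift c" ..
qed (auto simp: \<mu>_eq u_shift_def)

text \<open>Shifting \<open>u\<close> changes \<open>K\<close> by a constant and hence leaves both slopes unchanged. So all stages of a
  solution may be shifted by the same amount, and uniqueness of the stages identifies the result with
  the solution at the shifted point.\<close>

lemma sprk_step_u_shift: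
  assumes H: "smooth H" and solv: "sprk_solvable a b h (extended_hamiltonian H)"
  shows "sprk_step a b h (extended_hamiltonian H) (x + u_shift c) =
    sprk_step a b h (extended_hamiltonian H) x + u_shift c"
proof -
  let ?K = "extended_hamiltonian H"
  have K1: "?K differentiable (at z)" for z
    by (simp add: H smooth_extended_hamiltonian smooth_imp_differentiable)
  have "?K (z + u_shift c) = ?K z + c" for z
    by (simp add: extended_hamiltonian_def \<mu>_eq coord_eqs u_shift_def)
  then have "gradient ?K (z + u_shift c) = gradient ?K z" for z
    by (intro gradient_translate [OF K1])
  then have slopes: "k_slope ?K (z + u_shift c) = k_slope ?K z" "l_slope ?K (z + u_shift c) = l_slope ?K z" for z
    by (simp_all add: k_slope_eq_gradient l_slope_eq_gradient K1)
  have "sprk_solution a b h ?K (x + u_shift c) = (\<lambda>i. sprk_solution a b h ?K x i + u_shift c)"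
    using sprk_stages_sprk_solution [OF solv, of x]
    by (intro sprk_solution_eq [OF solv]) (simp add: sprk_stages_def slopes)
  then show ?thesis
    by (simp add: sprk_step_def Let_def slopes prod_eq_iff)
qed

theorem corollary4p4:
  fixes H :: "'n::finite evol_phase \<Rightarrow> real"
    and K :: "'n ext_phase \<Rightarrow> real"
    and a :: "'s::finite \<Rightarrow> 's \<Rightarrow> real"
    and b :: "'s \<Rightarrow> real"
    and h :: real
    and \<psi> :: "'n ext_phase \<Rightarrow> 'n ext_phase"
  assumes "smooth H"
    and "K = extended_hamiltonian H"
    and "sprk_coefficients a b"
    and "sprk_solvable a b h K"
    and "\<psi> = sprk_step a b h K"
    and "diffeomorphism \<psi>"
  shows "\<exists>\<phi>. canonical_transformation \<psi> \<phi>"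
proof -
  have shift: "\<psi> (x + u_shift c) = \<psi> x + u_shift c" for x c
    using assms sprk_step_u_shift by metis
  have "inj \<psi>"
    using assms by (simp add: diffeomorphism_def bij_is_inj)
  then have fib: "\<mu> (\<psi> x) = \<mu> (\<psi> y) \<longleftrightarrow> \<mu> x = \<mu> y" for x y
    unfolding \<mu>_eq_iff_u_shift by (metis shift injD)
  (* The section of \<mu> with u = 0; by equivariance every value of u induces the same map. *)
  define \<sigma> :: "'n evol_phase \<Rightarrow> 'n ext_phase" where
    "\<sigma> = (\<lambda>m. ((fst m, snd (snd m)), (fst (snd m), 0)))"
  have \<sigma>: "bounded_linear \<sigma>"
    unfolding \<sigma>_def
    by (intro bounded_linear_Pair bounded_linear_fst_comp bounded_linear_snd_comp bounded_linear_ident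
        bounded_linear_zero)
  have \<mu>\<sigma>: "\<mu> (\<sigma> m) = m" for m
    by (simp add: \<mu>_eq \<sigma>_def)
  have "Ck 2 K"
    using assms smooth_extended_hamiltonian unfolding smooth_def by blast
  then have "pullback \<psi> \<Omega>\<^sub>0 = \<Omega>\<^sub>0"
    using assms sprk_step_symplectic unfolding sprk_coefficients_def by blast
  moreover note descent = diffeomorphism_descends [where P = \<mu> and S = \<sigma>,
      OF assms(6) bounded_linear_\<mu> \<sigma> \<mu>\<sigma> fib]
  moreover have "\<mu> \<circ> \<psi> = (\<lambda>m. \<mu> (\<psi> (\<sigma> m))) \<circ> \<mu>"
    unfolding o_def using descent(2) by (rule ext)
  ultimately have "canonical_transformation \<psi> (\<lambda>m. \<mu> (\<psi> (\<sigma> m)))"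
    using assms(6) unfolding canonical_transformation_def by (intro conjI)
  then show ?thesis
    by (rule exI [of "canonical_transformation \<psi>"])
qed

end
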